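(* Let $\psi:[0,\infty)\to[0,\infty)$ be non-decreasing and left-continuous, let $n\ge 1$ and $\alpha\in(0,n)$. Then there exist constants $C_1=C_1(\alpha,n)>0$ and $C_2=C_2(\alpha,n)>0$ such that for every $t>0$ $$(\mathbf{W}_{\alpha,\psi} f)^{*}(t)\le C_1\int_t^\infty s^{\frac{\alpha}{n}-1}\,\psi\!\left(C_2\, s^{\frac{\alpha}{n}}f^{**}(s)\right)ds$$ whenever $f\in L^1_{loc}(\mathbb{R}^n)$ satisfies $|\{x\in\mathbb{R}^n:|f(x)|>\tau\}|<\infty$ for all $\tau>0$. The result is sharp in the following sense: there exist constants $C_3=C_3(\alpha,n)>0$ and $C_4=C_4(\alpha,n)>0$ such that for every $t>0$ $$C_3\int_t^\infty s^{\frac{\alpha}{n}-1}\,\psi\!\left(C_4\, s^{\frac{\alpha}{n}}f^{**}(s)\right)ds\le(\mathbf{W}_{\alpha,\psi} f)^{*}(t)$$ for every nonnegative, radially decreasing $f\in L^1_{loc}(\mathbb{R}^n)$ satisfying $|\{x:|f(x)|>\tau\}|<\infty$ for all $\tau>0$.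
   Context: For a non-decreasing $\psi:[0,\infty)\to[0,\infty)$ and $\alpha\in(0,n)$ the generalized Wolff-type potential is $$\mathbf{W}_{\alpha,\psi}f(x):=\int_0^\infty r^{\alpha-1}\psi\!\left(r^{\alpha-n}\int_{B(x,r)}|f(y)|\,dy\right)dr\in[0,\infty],\qquad x\in\mathbb{R}^n,$$ where $B(x,r)$ is the ball with centre $x$ and radius $r$. The decreasing rearrangement of a measurable function $f$ is $f^*(t):=\sup\{s\ge0:|\{x\in\mathbb{R}^n:|f(x)|>s\}|>t\}$ (with $\sup\emptyset=0$), and the maximal rearrangement is $f^{**}(t):=\frac1t\int_0^t f^*(s)\,ds$ for $t>0$. Here $|E|$ is Lebesgue measure. When an argument of $\psi$ is infinite, $\psi(\infty):=\lim_{s\to\infty}\psi(s)$. *)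

theory Defs
  imports "HOL-Analysis.Analysis"
begin

text \<open>
  Functions with values in \<open>[0,\<infinity>]\<close> have type \<^typ>\<open>'a \<Rightarrow> ennreal\<close>; a real-valued function \<open>f\<close> enters
  the rearrangements below through \<open>\<lambda>x. ennreal \<bar>f x\<bar>\<close>.
\<close>

definition locally_integrable :: "('a::euclidean_space \<Rightarrow> real) \<Rightarrow> bool" where
  "locally_integrable f \<longleftrightarrow> (\<forall>K. compact K \<longrightarrow> f absolutely_integrable_on K)"

text \<open>
  The value at the origin is left free: a real-valued function that decreases in \<open>norm x\<close> up to and
  including the origin would be bounded above by \<open>f 0\<close>, which would exclude locally integrable
  functions with a singularity there, such as negative powers of \<open>norm x\<close>.
\<close>

definition radially_decreasing :: "('a::real_normed_vector \<Rightarrow> real) \<Rightarrow> bool" where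
  "radially_decreasing f \<longleftrightarrow>
    (\<exists>g::real \<Rightarrow> real. antimono_on {0<..} g \<and> (\<forall>x. x \<noteq> 0 \<longrightarrow> f x = g (norm x)))"

text \<open>The supremum is taken in \<^typ>\<open>ennreal\<close>, where the supremum of the empty set is 0.\<close>

definition decreasing_rearrangement :: "('a::euclidean_space \<Rightarrow> ennreal) \<Rightarrow> real \<Rightarrow> ennreal" where
  "decreasing_rearrangement h t =
    Sup {ennreal s | s. 0 \<le> s \<and> emeasure lebesgue {x. h x > ennreal s} > ennreal t}"

definition maximal_rearrangement :: "('a::euclidean_space \<Rightarrow> ennreal) \<Rightarrow> real \<Rightarrow> ennreal" where
  "maximal_rearrangement h t =
    ennreal (1 / t) * (\<integral>\<^sup>+ s\<in>{0<..<t}. decreasing_rearrangement h s \<partial>lebesgue)"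

text \<open>Only the values of \<open>\<psi>\<close> on \<open>[0,\<infinity>)\<close> matter.\<close>

definition extend_profile :: "(real \<Rightarrow> real) \<Rightarrow> ennreal \<Rightarrow> ennreal" where
  "extend_profile \<psi> u =
    (if u = \<infinity> then Lim at_top (\<lambda>s. ennreal (\<psi> s)) else ennreal (\<psi> (enn2real u)))"

definition wolff_potential ::
  "real \<Rightarrow> (real \<Rightarrow> real) \<Rightarrow> ('a::euclidean_space \<Rightarrow> real) \<Rightarrow> 'a \<Rightarrow> ennreal" where
  "wolff_potential \<alpha> \<psi> f x =
    (\<integral>\<^sup>+ r\<in>{0<..}. ennreal (r powr (\<alpha> - 1)) *
      extend_profile \<psi> (ennreal (r powr (\<alpha> - DIM('a))) *
        (\<integral>\<^sup>+ y\<in>ball x r. ennreal \<bar>f y\<bar> \<partial>lebesgue)) \<partial>lebesgue)"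

end

theory Submission
  imports Defs
begin

text \<open>
  Since \<open>h\<^sup>*(u)\<close> is the length of the interval \<open>{s \<ge> 0. u < \<bar>{h > s}\<bar>}\<close>, Fubini gives
  \<open>F(v) := \<integral>\<^sub>0\<^sup>v h\<^sup>* = \<integral>\<^sub>0\<^sup>\<infinity> min(v, \<bar>{h > s}\<bar>) ds\<close>. From this formula one reads off that \<open>F(v)\<close>
  increases, that \<open>F(v)/v\<close> decreases, and that \<open>\<integral>\<^sub>E h \<le> F(\<bar>E\<bar>)\<close>, with equality for centred
  balls when \<open>h\<close> is radially decreasing.

  Upper bound: let \<open>\<bar>B(0,\<rho>)\<bar> = t\<close>. For \<open>r > \<rho>\<close> the integral of \<open>\<bar>f\<bar>\<close> over \<open>B(x,r)\<close> is at most
  \<open>F(\<bar>B(x,r)\<bar>)\<close>, and \<open>r = c s\<^sup>1\<^sup>/\<^sup>n\<close> turns this part of the potential into the right-hand side.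
  For \<open>r \<le> \<rho>\<close> a Vitali covering argument bounds the averages of \<open>\<bar>f\<bar>\<close> by
  \<open>f\<^sup>*\<^sup>*(5\<^sup>-\<^sup>n t) \<le> 5\<^sup>n f\<^sup>*\<^sup>*(t)\<close> off a set of measure \<open>t\<close>, and the resulting constant is absorbed by
  the part of the right-hand side over \<open>(t, 2t)\<close>.

  Lower bound: if \<open>\<bar>x\<bar> < \<rho>\<close> and \<open>r > 2\<rho>\<close>, then \<open>B(x,r)\<close> contains \<open>B(0,r/2)\<close>. Taking
  \<open>\<bar>B(0,\<rho>)\<bar> = 2t\<close> makes the potential large on a set of measure \<open>2t > t\<close>.
\<close>

section \<open>Rearrangements and superlevel sets\<close>

text \<open>This is the distribution function of \<open>h\<close>.\<close>

definition superlevel_measure :: "('a::euclidean_space \<Rightarrow> ennreal) \<Rightarrow> real \<Rightarrow> ennreal" where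
  "superlevel_measure h s = emeasure lebesgue {x. h x > ennreal s}"

text \<open>This is F(v) of the overview, given by its layer-cake form: with the minimum under the
  integral, comparisons between different v hold pointwise in s.\<close>

definition rearrangement_mass :: "('a::euclidean_space \<Rightarrow> ennreal) \<Rightarrow> real \<Rightarrow> ennreal" where
  "rearrangement_mass h v = (\<integral>\<^sup>+ s\<in>{0..}. min (ennreal v) (superlevel_measure h s) \<partial>lborel)"

section \<open>Inner integrals and measurability for the Fubini arguments\<close>

lemma emeasure_lborel_below: "emeasure lborel {s. 0 \<le> s \<and> ennreal s < m} = m"
proof (cases m)
  case (real r)
  then have "{s. 0 \<le> s \<and> ennreal s < m} = {0..<r}"
    by (auto simp: ennreal_less_iff)
  then show ?thesis using real by simp
next
  case top
  then have "{s. 0 \<le> s \<and> ennreal s < m} = {0..}" by auto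
  moreover have "emeasure lborel {0::real..} = \<infinity>"
  proof -
    have "ennreal (real k) \<le> emeasure lborel {0::real..}" for k
      using emeasure_mono[of "{0..real k}" "{0..}" lborel] by simp
    then show ?thesis
      by (metis ennreal_Ex_less_of_nat ennreal_of_nat_eq_real_of_nat infinity_ennreal_def
          not_less top.not_eq_extremum)
  qed
  ultimately show ?thesis using top by simp
qed

text \<open>The truncation at v is what produces the minimum in
  \<open>rearrangement_mass\<close>.\<close>

lemma emeasure_lborel_below_min:
  "emeasure lborel {u. 0 < u \<and> u < v \<and> ennreal u < m} = min (ennreal v) m"
proof (cases m)
  case (real r)
  then have eq: "{u. 0 < u \<and> u < v \<and> ennreal u < m} = {0<..<min v r}"
    by (auto simp: ennreal_less_iff)
  show ?thesis
    unfolding eq using real by (cases "v \<ge> 0") (auto simp: min_def ennreal_neg)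
next
  case top
  then have eq: "{u. 0 < u \<and> u < v \<and> ennreal u < m} = {0<..<v}" by auto
  show ?thesis
    unfolding eq using top by (cases "v \<ge> 0") (auto simp: ennreal_neg)
qed

text \<open>Lebesgue measure is the completion of \<open>lborel\<close>; this makes it admissible as
  a factor in Fubini's theorem.\<close>

lemma sigma_finite_measure_completion:
  assumes "sigma_finite_measure M"
  shows "sigma_finite_measure (completion M)"
proof -
  obtain A where A: "countable A" "A \<subseteq> sets M" "\<Union>A = space M" "\<And>a. a \<in> A \<Longrightarrow> emeasure M a \<noteq> \<infinity>"
    using sigma_finite_measure.sigma_finite_countable[OF assms] by blast
  then have "A \<subseteq> sets (completion M)" by auto
  moreover have "emeasure (completion M) a \<noteq> \<infinity>" if "a \<in> A" for a
    using A that by auto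
  ultimately show ?thesis
    using A by (auto simp: sigma_finite_measure_def)
qed

text \<open>Superlevel sets of a monotone function are intervals. This serves the distribution
  function and F.\<close>

lemma borel_measurable_monotone_real:
  fixes g :: "real \<Rightarrow> ennreal"
  assumes "mono g \<or> antimono g"
  shows "g \<in> borel_measurable borel"
proof (rule borel_measurableI_greater)
  fix y
  have "is_interval {x. y < g x}"
    unfolding is_interval_1
  proof safe
    fix a b x assume "y < g a" "y < g b" "a \<le> x" "x \<le> b"
    then show "y < g x"
      using assms less_le_trans[of y "g a" "g x"] less_le_trans[of y "g b" "g x"]
      by (auto dest: monoD antimonoD)
  qed
  then show "{x \<in> space borel. y < g x} \<in> sets borel"
    by (simp add: real_interval_borel_measurable)
qed

text \<open>A superlevel set is closed upwards, so it is the closed or the open ray from its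
  infimum. This serves the extended profile.\<close>

lemma borel_measurable_mono_ennreal:
  fixes g :: "ennreal \<Rightarrow> ennreal"
  assumes "mono g"
  shows "g \<in> borel_measurable borel"
proof (rule borel_measurableI_greater)
  fix y
  let ?S = "{x. y < g x}"
  have up: "z \<in> ?S" if "x \<in> ?S" "x \<le> z" for x z
    using monoD[OF assms that(2)] that(1) less_le_trans[of y "g x" "g z"] by simp
  obtain i where "?S = {i..} \<or> ?S = {i<..}"
  proof (cases "Inf ?S \<in> ?S")
    case True
    have "?S = {Inf ?S..}"
    proof (rule set_eqI, rule iffI)
      fix x assume "x \<in> ?S" then show "x \<in> {Inf ?S..}" by (simp add: Inf_lower)
    next
      fix x assume "x \<in> {Inf ?S..}" then show "x \<in> ?S" using up[OF True, of x] by blast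
    qed
    then show ?thesis using that by blast
  next
    case False
    have "?S = {Inf ?S<..}"
    proof (rule set_eqI, rule iffI)
      fix x assume x: "x \<in> ?S"
      then have "Inf ?S \<le> x" "Inf ?S \<noteq> x" using False by (auto intro: Inf_lower)
      then show "x \<in> {Inf ?S<..}" by (simp add: less_le)
    next
      fix x assume "x \<in> {Inf ?S<..}"
      then obtain w where "w \<in> ?S" "w < x" by (auto simp: Inf_less_iff)
      then show "x \<in> ?S" using up[of w x] by auto
    qed
    then show ?thesis using that by blast
  qed
  then have "?S \<in> sets borel"
    using borel_closed[OF closed_atLeast, of i] borel_open[OF open_greaterThan, of i] by metis
  then show "{x \<in> space borel. y < g x} \<in> sets borel" by simp
qed

lemma antimono_superlevel_measure:
  fixes h :: "'a::euclidean_space \<Rightarrow> ennreal"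
  assumes [measurable]: "h \<in> borel_measurable lebesgue"
  shows "antimono (superlevel_measure h)"
proof (rule antimonoI)
  fix a b :: real assume "a \<le> b"
  then have "ennreal a \<le> ennreal b" by (rule ennreal_leI)
  moreover have "{x \<in> space lebesgue. ennreal a < h x} \<in> sets lebesgue" by measurable
  ultimately show "superlevel_measure h b \<le> superlevel_measure h a"
    unfolding superlevel_measure_def by (intro emeasure_mono) auto
qed

text \<open>The number h(x) is the length of the set of s \<ge> 0 below it; Fubini on the region
  under the graph exchanges x and s.\<close>

lemma layer_cake:
  fixes h :: "'a::euclidean_space \<Rightarrow> ennreal"
  assumes [measurable]: "h \<in> borel_measurable lebesgue" "E \<in> sets lebesgue"
  shows "(\<integral>\<^sup>+ x\<in>E. h x \<partial>lebesgue)
    = (\<integral>\<^sup>+ s\<in>{0..}. emeasure lebesgue (E \<inter> {x. ennreal s < h x}) \<partial>lborel)"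
proof -
  interpret L: sigma_finite_measure "lebesgue :: 'a measure"
    by (rule sigma_finite_measure_completion[OF sigma_finite_lborel])
  interpret pair_sigma_finite "lebesgue :: 'a measure" "lborel :: real measure" ..
  let ?k = "\<lambda>x s. indicator E x * indicator {p. 0 \<le> snd p \<and> ennreal (snd p) < h (fst p)} (x, s) :: ennreal"
  have meas: "case_prod ?k \<in> borel_measurable (lebesgue \<Otimes>\<^sub>M lborel)"
    by measurable
  have "(\<integral>\<^sup>+ s. ?k x s \<partial>lborel) = h x * indicator E x" for x
  proof -
    have "(\<integral>\<^sup>+ s. ?k x s \<partial>lborel)
      = (\<integral>\<^sup>+ s. indicator E x * indicator {s. 0 \<le> s \<and> ennreal s < h x} s \<partial>lborel)"
      by (intro nn_integral_cong) (auto simp: indicator_def)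
    also have "\<dots> = indicator E x * emeasure lborel {s. 0 \<le> s \<and> ennreal s < h x}"
      by (rule nn_integral_cmult_indicator) measurable
    finally show ?thesis by (simp add: emeasure_lborel_below mult.commute)
  qed
  moreover have "(\<integral>\<^sup>+ x. ?k x s \<partial>lebesgue)
      = emeasure lebesgue (E \<inter> {x. ennreal s < h x}) * indicator {0..} s" for s
  proof -
    have "{x \<in> space lebesgue. ennreal s < h x} \<in> sets lebesgue" by measurable
    then have S: "E \<inter> {x. ennreal s < h x} \<in> sets lebesgue" using assms(2) by auto
    have "(\<integral>\<^sup>+ x. ?k x s \<partial>lebesgue)
      = (\<integral>\<^sup>+ x. indicator {0..} s * indicator (E \<inter> {x. ennreal s < h x}) x \<partial>lebesgue)"
      by (intro nn_integral_cong) (auto simp: indicator_def)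
    also have "\<dots> = indicator {0..} s * emeasure lebesgue (E \<inter> {x. ennreal s < h x})"
      using S by (rule nn_integral_cmult_indicator)
    finally show ?thesis by (simp add: mult.commute)
  qed
  ultimately show ?thesis
    using Fubini'[OF meas] by simp
qed

text \<open>The distribution function decreases, so the set is empty or an interval starting at 0,
  and its length is its supremum. A supremum thereby becomes an integral.\<close>

lemma decreasing_rearrangement_eq_emeasure:
  fixes h :: "'a::euclidean_space \<Rightarrow> ennreal"
  assumes h: "h \<in> borel_measurable lebesgue"
  shows "decreasing_rearrangement h u
    = emeasure lborel {s. 0 \<le> s \<and> ennreal u < superlevel_measure h s}"
proof (rule antisym)
  let ?A = "{s. 0 \<le> s \<and> ennreal u < superlevel_measure h s}"
  have eq: "decreasing_rearrangement h u = Sup (ennreal ` ?A)"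
    unfolding decreasing_rearrangement_def superlevel_measure_def
    by (intro arg_cong[where f = Sup]) auto
  have down: "r \<in> ?A" if "s \<in> ?A" "0 \<le> r" "r \<le> s" for r s
    using that antimonoD[OF antimono_superlevel_measure[OF h], of r s]
    by (simp add: less_le_trans[of _ "superlevel_measure h s"])
  have "is_interval ?A"
    using down by (auto simp: is_interval_1)
  then have A: "?A \<in> sets lborel" by (simp add: real_interval_borel_measurable)
  show "decreasing_rearrangement h u \<le> emeasure lborel ?A"
    unfolding eq
  proof (rule Sup_least, safe)
    fix s assume s: "0 \<le> s" "ennreal u < superlevel_measure h s"
    then have "{0..s} \<subseteq> ?A" using down by auto
    from emeasure_mono[OF this A] s show "ennreal s \<le> emeasure lborel ?A" by simp
  qed
  show "emeasure lborel ?A \<le> decreasing_rearrangement h u"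
  proof (cases "decreasing_rearrangement h u")
    case (real r)
    have "s \<le> r" if "s \<in> ?A" for s
    proof -
      have "ennreal s \<le> ennreal r" unfolding real(2)[symmetric] eq by (rule Sup_upper) (use that in auto)
      then show ?thesis using real(1) by (simp add: ennreal_le_iff)
    qed
    then have "?A \<subseteq> {0..r}" by auto
    from emeasure_mono[OF this, of lborel] real show ?thesis by simp
  qed simp
qed

text \<open>Fubini on the region where u < |{h > s}| and 0 < u < v: integrating first in s gives
  h^*(u), integrating first in u gives the minimum.\<close>

lemma nn_integral_decreasing_rearrangement:
  fixes h :: "'a::euclidean_space \<Rightarrow> ennreal"
  assumes h: "h \<in> borel_measurable lebesgue"
  shows "(\<integral>\<^sup>+ s\<in>{0<..<v}. decreasing_rearrangement h s \<partial>lebesgue) = rearrangement_mass h v"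
proof -
  have [measurable]: "superlevel_measure h \<in> borel_measurable borel"
    using borel_measurable_monotone_real antimono_superlevel_measure[OF h] by blast
  let ?k = "\<lambda>u s. indicator {0<..<v} u
      * indicator {p. 0 \<le> snd p \<and> ennreal (fst p) < superlevel_measure h (snd p)} (u, s) :: ennreal"
  have meas: "case_prod ?k \<in> borel_measurable (lborel \<Otimes>\<^sub>M lborel)"
    by measurable
  have "(\<integral>\<^sup>+ s. ?k u s \<partial>lborel) = decreasing_rearrangement h u * indicator {0<..<v} u" for u
  proof -
    have "(\<integral>\<^sup>+ s. ?k u s \<partial>lborel) = (\<integral>\<^sup>+ s. indicator {0<..<v} u
        * indicator {s. 0 \<le> s \<and> ennreal u < superlevel_measure h s} s \<partial>lborel)"
      by (intro nn_integral_cong) (auto simp: indicator_def)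
    also have "\<dots> = indicator {0<..<v} u
        * emeasure lborel {s. 0 \<le> s \<and> ennreal u < superlevel_measure h s}"
      by (rule nn_integral_cmult_indicator) measurable
    finally show ?thesis by (simp add: decreasing_rearrangement_eq_emeasure[OF h] mult.commute)
  qed
  moreover have "(\<integral>\<^sup>+ u. ?k u s \<partial>lborel)
      = min (ennreal v) (superlevel_measure h s) * indicator {0..} s" for s
  proof -
    have "(\<integral>\<^sup>+ u. ?k u s \<partial>lborel) = (\<integral>\<^sup>+ u. indicator {0..} s
        * indicator {u. 0 < u \<and> u < v \<and> ennreal u < superlevel_measure h s} u \<partial>lborel)"
      by (intro nn_integral_cong) (auto simp: indicator_def)
    also have "\<dots> = indicator {0..} s
        * emeasure lborel {u. 0 < u \<and> u < v \<and> ennreal u < superlevel_measure h s}"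
      by (rule nn_integral_cmult_indicator) measurable
    finally show ?thesis by (simp add: emeasure_lborel_below_min mult.commute)
  qed
  ultimately show ?thesis
    using lborel_pair.Fubini'[OF meas] by (simp add: rearrangement_mass_def nn_integral_completion)
qed

lemma rearrangement_mass_mono: "v \<le> w \<Longrightarrow> rearrangement_mass h v \<le> rearrangement_mass h w"
  unfolding rearrangement_mass_def
  by (intro nn_integral_mono mult_right_mono min.mono ennreal_leI) auto

lemma maximal_rearrangement_eq:
  assumes "h \<in> borel_measurable lebesgue"
  shows "maximal_rearrangement h v = ennreal (1 / v) * rearrangement_mass h v"
  by (simp add: maximal_rearrangement_def nn_integral_decreasing_rearrangement[OF assms])

text \<open>F(v)/v decreases because min(w, m) \<le> (w/v) min(v, m) for every m.\<close>

lemma rearrangement_mass_scale: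
  assumes h: "h \<in> borel_measurable lebesgue" and v: "0 < v" "v \<le> w"
  shows "rearrangement_mass h w \<le> ennreal (w / v) * rearrangement_mass h v"
proof -
  have [measurable]: "superlevel_measure h \<in> borel_measurable borel"
    using borel_measurable_monotone_real antimono_superlevel_measure[OF h] by blast
  have "min (ennreal w) m \<le> ennreal (w / v) * min (ennreal v) m" for m
  proof -
    have "ennreal w = ennreal (w / v) * ennreal v"
      using v by (simp flip: ennreal_mult)
    moreover have "m \<le> ennreal (w / v) * m"
      using v mult_right_mono[of 1 "ennreal (w / v)" m] by simp
    ultimately show ?thesis
      by (cases "ennreal v \<le> m") (simp_all add: min.coboundedI1 min.coboundedI2)
  qed
  then have "rearrangement_mass h w
      \<le> (\<integral>\<^sup>+ s. ennreal (w / v) * (min (ennreal v) (superlevel_measure h s) * indicator {0..} s) \<partial>lborel)"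
    unfolding rearrangement_mass_def mult.assoc[symmetric]
    by (intro nn_integral_mono mult_right_mono) auto
  also have "\<dots> = ennreal (w / v) * rearrangement_mass h v"
    unfolding rearrangement_mass_def by (rule nn_integral_cmult) measurable
  finally show ?thesis .
qed

text \<open>In the layer-cake formula, the measure of an intersection is at most the smaller of the
  two measures.\<close>

lemma hardy_littlewood:
  assumes h: "h \<in> borel_measurable lebesgue" and E: "E \<in> sets lebesgue"
    and v: "emeasure lebesgue E \<le> ennreal v"
  shows "(\<integral>\<^sup>+ x\<in>E. h x \<partial>lebesgue) \<le> rearrangement_mass h v"
  unfolding layer_cake[OF h E] rearrangement_mass_def superlevel_measure_def
proof (rule nn_integral_mono, rule mult_right_mono, rule min.boundedI)
  fix s :: real
  have S: "{x. ennreal s < h x} \<in> sets lebesgue"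
    using borel_measurable_less[of "\<lambda>_. ennreal s" lebesgue h] h by simp
  show "emeasure lebesgue (E \<inter> {x. ennreal s < h x}) \<le> ennreal v"
    using emeasure_mono[OF Int_lower1 E] v by (rule order_trans)
  show "emeasure lebesgue (E \<inter> {x. ennreal s < h x}) \<le> emeasure lebesgue {x. ennreal s < h x}"
    using S by (intro emeasure_mono) auto
qed simp

text \<open>Equality in the previous estimate: superlevel sets of f and centred balls are nested up
  to the origin, so their intersection has exactly the smaller measure.\<close>

lemma radially_decreasing_mass:
  fixes f :: "'a::euclidean_space \<Rightarrow> real"
  assumes rad: "radially_decreasing f" and nonneg: "\<And>x. 0 \<le> f x"
    and meas: "f \<in> borel_measurable lebesgue" and r: "0 \<le> r"
  shows "(\<integral>\<^sup>+ x\<in>ball 0 r. ennreal \<bar>f x\<bar> \<partial>lebesgue)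
    = rearrangement_mass (\<lambda>x. ennreal \<bar>f x\<bar>) (unit_ball_vol DIM('a) * r ^ DIM('a))"
proof -
  let ?h = "\<lambda>x. ennreal \<bar>f x\<bar>" and ?B = "ball (0::'a) r"
  have h: "?h \<in> borel_measurable lebesgue" using meas by measurable
  obtain g where g: "antimono_on {0<..} g" "\<And>x. x \<noteq> 0 \<Longrightarrow> f x = g (norm x)"
    using rad unfolding radially_decreasing_def by blast
  have B: "emeasure lebesgue ?B = ennreal (unit_ball_vol DIM('a) * r ^ DIM('a))"
    using r by (simp add: emeasure_ball)
  have eq: "emeasure lebesgue (?B \<inter> {x. ennreal s < ?h x})
      = min (emeasure lebesgue ?B) (emeasure lebesgue {x. ennreal s < ?h x})" for s
  proof -
    let ?S = "{x. ennreal s < ?h x}"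
    have S: "?S \<in> sets lebesgue"
      using borel_measurable_less[of "\<lambda>_. ennreal s" lebesgue ?h] h by simp
    \<comment> \<open>The value of f at the origin is unconstrained, so this point is removed before
      the sets are compared.\<close>
    have null: "{0::'a} \<in> null_sets lebesgue"
      by (simp add: null_sets_completion_iff)
    have diff: "emeasure lebesgue (A - {0}) = emeasure lebesgue A"
      if "A \<in> sets lebesgue" for A :: "'a set"
      using that null by (rule emeasure_Diff_null_set[rotated])
    have BS: "?B \<inter> ?S \<in> sets lebesgue" and B': "?B \<in> sets lebesgue"
      using S by (auto intro: sets.Int)
    have d: "emeasure lebesgue (?B \<inter> ?S - {0}) = emeasure lebesgue (?B \<inter> ?S)"
      "emeasure lebesgue (?B - {0}) = emeasure lebesgue ?B"
      "emeasure lebesgue (?S - {0}) = emeasure lebesgue ?S"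
      by (rule diff[OF BS], rule diff[OF B'], rule diff[OF S])
    \<comment> \<open>If neither contained the other, a point x of the ball outside
      \<open>?S\<close> would be closer to the origin than a point y of \<open>?S\<close> outside
      the ball, although f is larger at y.\<close>
    have "?B - {0} \<subseteq> ?S - {0} \<or> ?S - {0} \<subseteq> ?B - {0}"
    proof (rule ccontr)
      assume "\<not> ?thesis"
      then obtain x y where x: "x \<in> ?B" "x \<noteq> 0" "x \<notin> ?S" and y: "y \<in> ?S" "y \<noteq> 0" "y \<notin> ?B" by blast
      then have "norm x \<le> norm y" by auto
      then have "g (norm y) \<le> g (norm x)"
        using g(1) x y by (auto simp: monotone_on_def)
      then have "?h y \<le> ?h x"
        using g(2) x(2) y(2) nonneg[of x] nonneg[of y] by (intro ennreal_leI) simp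
      then show False using x(3) y(1) by (metis less_le_trans mem_Collect_eq)
    qed
    then show ?thesis
    proof
      assume sub: "?B - {0} \<subseteq> ?S - {0}"
      then have "emeasure lebesgue (?B - {0}) \<le> emeasure lebesgue (?S - {0})"
        using S by (intro emeasure_mono) auto
      moreover have "(?B \<inter> ?S) - {0} = ?B - {0}" using sub by blast
      ultimately show ?thesis
        using d by (metis min.absorb1)
    next
      assume sub: "?S - {0} \<subseteq> ?B - {0}"
      then have "emeasure lebesgue (?S - {0}) \<le> emeasure lebesgue (?B - {0})"
        by (intro emeasure_mono) auto
      moreover have "(?B \<inter> ?S) - {0} = ?S - {0}" using sub by blast
      ultimately show ?thesis
        using d by (metis min.absorb2)
    qed
  qed
  have "?B \<in> sets lebesgue" by simp
  then show ?thesis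
    unfolding layer_cake[OF h \<open>?B \<in> sets lebesgue\<close>] rearrangement_mass_def superlevel_measure_def
    by (simp only: eq B)
qed

section \<open>Profiles and the change of variables\<close>

lemma mono_extend_profile:
  assumes mono: "mono_on {0..} \<psi>"
  shows "mono (extend_profile \<psi>)"
proof -
  \<comment> \<open>Monotonicity turns the limit at infinity into a supremum, which dominates every
    finite value.\<close>
  let ?L = "SUP s\<in>{0..}. ennreal (\<psi> s)"
  have "((\<lambda>s. ennreal (\<psi> s)) \<longlongrightarrow> ?L) at_top"
  proof (rule order_tendstoI)
    fix a assume "a < ?L"
    then obtain s where s: "0 \<le> s" "a < ennreal (\<psi> s)" by (auto simp: less_SUP_iff)
    show "\<forall>\<^sub>F x in at_top. a < ennreal (\<psi> x)"
      using eventually_ge_at_top[of s]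
    proof eventually_elim
      case (elim x)
      then have "\<psi> s \<le> \<psi> x" using mono s by (auto simp: monotone_on_def)
      then show ?case by (rule less_le_trans[OF s(2) ennreal_leI])
    qed
  next
    fix a assume a: "?L < a"
    show "\<forall>\<^sub>F x in at_top. ennreal (\<psi> x) < a"
      using eventually_ge_at_top[of 0]
    proof eventually_elim
      case (elim x)
      then have "ennreal (\<psi> x) \<le> ?L" by (intro SUP_upper) auto
      then show ?case using a by simp
    qed
  qed
  then have lim: "Lim at_top (\<lambda>s. ennreal (\<psi> s)) = ?L"
    by (intro tendsto_Lim) auto
  show ?thesis
  proof (rule monoI)
    fix u v :: ennreal assume "u \<le> v"
    then show "extend_profile \<psi> u \<le> extend_profile \<psi> v"
      unfolding extend_profile_def lim
      using mono enn2real_mono[of u v]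
      by (auto simp: monotone_on_def top_unique less_top intro!: SUP_upper ennreal_leI)
  qed
qed

text \<open>Substitution r = c s^p on the compact intervals from t to \<open>b k\<close>, followed
  by monotone convergence as k grows. Open and closed rays differ by one point, a null set.\<close>

lemma nn_integral_powr_substitution:
  fixes G :: "real \<Rightarrow> ennreal"
  assumes [measurable]: "G \<in> borel_measurable borel" and c: "0 < c" and p: "0 < p" and t: "0 < t"
  shows "(\<integral>\<^sup>+ r\<in>{c * t powr p<..}. G r \<partial>lborel)
    = (\<integral>\<^sup>+ s\<in>{t<..}. ennreal (c * p * s powr (p - 1)) * G (c * s powr p) \<partial>lborel)"
proof -
  let ?g = "\<lambda>s. c * s powr p" and ?g' = "\<lambda>s. c * p * s powr (p - 1)"
  define b where "b k = t + 1 + real k" for k :: nat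
  have bt: "t < b k" for k using t by (simp add: b_def)
  have bm: "b k \<le> b l" if "k \<le> l" for k l using that by (simp add: b_def)
  have gm: "?g x \<le> ?g y" if "0 < x" "x \<le> y" for x y
    using that c p by (auto intro: powr_mono2)
  let ?u = "\<lambda>k r. G r * indicator {?g t..?g (b k)} r"
  let ?v = "\<lambda>k s. G (?g s) * ennreal (?g' s) * indicator {t..b k} s"
  have eq: "(\<integral>\<^sup>+ r. ?u k r \<partial>lborel) = (\<integral>\<^sup>+ s. ?v k s \<partial>lborel)" for k
    using c p t bt[of k]
    by (intro nn_integral_substitution_aux[where g = ?g and g' = ?g'])
       (auto intro!: derivative_eq_intros continuous_intros simp: field_simps powr_diff)
  have bt_unbounded: "\<forall>\<^sub>F k in sequentially. x \<le> b k" for x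
  proof -
    obtain N where "x \<le> real N" using real_arch_simple by blast
    then have "x \<le> b k" if "k \<ge> N" for k using that t by (simp add: b_def)
    then show ?thesis unfolding eventually_sequentially by blast
  qed
  have "(\<lambda>k. \<integral>\<^sup>+ r. ?u k r \<partial>lborel) \<longlonglongrightarrow> (\<integral>\<^sup>+ r. G r * indicator {?g t..} r \<partial>lborel)"
  proof (rule nn_integral_LIMSEQ)
    show "incseq ?u"
    proof (rule monoI, rule le_funI, rule mult_left_mono)
      fix k l :: nat and r assume "k \<le> l"
      then have "?g (b k) \<le> ?g (b l)" using bm[of k l] less_trans[OF t bt] by (intro gm)
      then show "indicator {?g t..?g (b k)} r \<le> (indicator {?g t..?g (b l)} r :: ennreal)"
        by (auto split: split_indicator)
    qed auto
    fix r
    have "\<forall>\<^sub>F k in sequentially. ?u k r = G r * indicator {?g t..} r"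
      \<comment> \<open>Beyond this threshold c (b k)^p \<ge> max(r, 1) \<ge> r; the maximum with 1
        keeps the base of the power positive.\<close>
      using bt_unbounded[of "(max r 1 / c) powr (1 / p)"]
    proof eventually_elim
      case (elim k)
      have "max r 1 / c = ((max r 1 / c) powr (1 / p)) powr p"
        using c p by (simp add: powr_powr)
      also have "\<dots> \<le> b k powr p"
        using elim p by (intro powr_mono2) auto
      finally have "r \<le> ?g (b k)" using c by (simp add: field_simps)
      then show ?case by (auto split: split_indicator)
    qed
    then show "(\<lambda>k. ?u k r) \<longlonglongrightarrow> G r * indicator {?g t..} r"
      by (rule tendsto_eventually)
  qed measurable
  moreover have "(\<lambda>k. \<integral>\<^sup>+ s. ?v k s \<partial>lborel)
      \<longlonglongrightarrow> (\<integral>\<^sup>+ s. G (?g s) * ennreal (?g' s) * indicator {t..} s \<partial>lborel)"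
  proof (rule nn_integral_LIMSEQ)
    show "incseq ?v"
    proof (rule monoI, rule le_funI, rule mult_left_mono)
      fix k l :: nat and r assume "k \<le> l"
      then show "indicator {t..b k} r \<le> (indicator {t..b l} r :: ennreal)"
        using bm[of k l] by (auto split: split_indicator)
    qed auto
    fix s
    have "\<forall>\<^sub>F k in sequentially. ?v k s = G (?g s) * ennreal (?g' s) * indicator {t..} s"
      using bt_unbounded[of s] by eventually_elim (auto split: split_indicator)
    then show "(\<lambda>k. ?v k s) \<longlonglongrightarrow> G (?g s) * ennreal (?g' s) * indicator {t..} s"
      by (rule tendsto_eventually)
  qed measurable
  ultimately have "(\<integral>\<^sup>+ r. G r * indicator {?g t..} r \<partial>lborel)
      = (\<integral>\<^sup>+ s. G (?g s) * ennreal (?g' s) * indicator {t..} s \<partial>lborel)"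
    unfolding eq by (rule LIMSEQ_unique)
  moreover have "(\<integral>\<^sup>+ r. G r * indicator {?g t..} r \<partial>lborel) = (\<integral>\<^sup>+ r\<in>{?g t<..}. G r \<partial>lborel)"
    by (rule nn_integral_cong_AE, rule AE_mp[OF AE_lborel_singleton[of "?g t"]])
       (auto split: split_indicator)
  moreover have "(\<integral>\<^sup>+ s. G (?g s) * ennreal (?g' s) * indicator {t..} s \<partial>lborel)
      = (\<integral>\<^sup>+ s\<in>{t<..}. ennreal (?g' s) * G (?g s) \<partial>lborel)"
    by (rule nn_integral_cong_AE, rule AE_mp[OF AE_lborel_singleton[of t]])
       (auto split: split_indicator simp: mult.commute)
  ultimately show ?thesis by simp
qed

section \<open>Measurability of the potential\<close>

text \<open>f is the pointwise limit of its cutoffs to the closed balls of radius k.\<close>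

lemma locally_integrable_measurable:
  fixes f :: "'a::euclidean_space \<Rightarrow> real"
  assumes "locally_integrable f"
  shows "f \<in> borel_measurable lebesgue"
proof (rule borel_measurable_LIMSEQ_metric)
  fix k :: nat
  have "f absolutely_integrable_on cball 0 (real k)"
    using assms by (simp add: locally_integrable_def)
  then show "(\<lambda>x. indicator (cball 0 (real k)) x *\<^sub>R f x) \<in> borel_measurable lebesgue"
    by (auto simp: set_integrable_def)
next
  fix x :: 'a
  obtain N where "norm x \<le> real N" using real_arch_simple by blast
  then have "\<forall>k\<ge>N. indicator (cball 0 (real k)) x *\<^sub>R f x = f x" by auto
  then show "(\<lambda>k. indicator (cball 0 (real k)) x *\<^sub>R f x) \<longlonglongrightarrow> f x"
    by (intro tendsto_eventually) (auto simp: eventually_sequentially)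
qed

text \<open>Replacing h by an almost everywhere equal Borel function makes this an integral with
  parameters of a jointly Borel function, since dist x y < r is a Borel condition on the
  triple.\<close>

lemma borel_measurable_ball_integral:
  fixes h :: "'a::euclidean_space \<Rightarrow> ennreal"
  assumes "h \<in> borel_measurable lebesgue"
  shows "(\<lambda>(x, r). \<integral>\<^sup>+ y\<in>ball x r. h y \<partial>lebesgue) \<in> borel_measurable (borel \<Otimes>\<^sub>M borel)"
proof -
  obtain h' where h': "h' \<in> borel_measurable lborel" "AE y in lborel. h y = h' y"
    using completion_ex_borel_measurable[OF assms] by blast
  note [measurable] = h'(1)
  have "(\<integral>\<^sup>+ y\<in>ball x r. h y \<partial>lebesgue)
      = (\<integral>\<^sup>+ y. h' y * indicator {p. dist (fst (fst p)) (snd p) < snd (fst p)} ((x, r), y) \<partial>lborel)" for x r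
    unfolding nn_integral_completion
    by (rule nn_integral_cong_AE, rule AE_mp[OF h'(2)]) (auto split: split_indicator)
  moreover have "(\<lambda>p. \<integral>\<^sup>+ y. h' y * indicator {p. dist (fst (fst p)) (snd p) < snd (fst p)} (p, y) \<partial>lborel)
      \<in> borel_measurable ((borel :: 'a measure) \<Otimes>\<^sub>M borel)"
    by measurable
  ultimately show ?thesis by (simp add: case_prod_beta')
qed

text \<open>The lower bound places a ball inside a superlevel set of the potential and compares
  measures, which requires that superlevel set to be measurable.\<close>

lemma borel_measurable_wolff_potential:
  fixes f :: "'a::euclidean_space \<Rightarrow> real"
  assumes f: "f \<in> borel_measurable lebesgue" and \<psi>: "mono_on {0..} \<psi>"
  shows "wolff_potential \<alpha> \<psi> f \<in> borel_measurable borel"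
proof -
  have [measurable]: "extend_profile \<psi> \<in> borel_measurable borel"
    by (rule borel_measurable_mono_ennreal[OF mono_extend_profile[OF \<psi>]])
  let ?I = "\<lambda>p. \<integral>\<^sup>+ y\<in>ball (fst p) (snd p). ennreal \<bar>f y\<bar> \<partial>lebesgue"
  have "(\<lambda>x. ennreal \<bar>f x\<bar>) \<in> borel_measurable lebesgue"
    using f by measurable
  then have I: "?I \<in> borel_measurable ((borel :: 'a measure) \<Otimes>\<^sub>M borel)"
    using borel_measurable_ball_integral by (simp only: case_prod_beta')
  have sets_eq: "sets ((borel :: 'a measure) \<Otimes>\<^sub>M (lborel :: real measure)) = sets (borel \<Otimes>\<^sub>M borel)"
    by (rule sets_pair_measure_cong) simp_all
  have [measurable]: "?I \<in> borel_measurable ((borel :: 'a measure) \<Otimes>\<^sub>M lborel)"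
    unfolding measurable_cong_sets[OF sets_eq refl] by (rule I)
  let ?k = "\<lambda>p. ennreal (snd p powr (\<alpha> - 1)) *
      extend_profile \<psi> (ennreal (snd p powr (\<alpha> - DIM('a))) * ?I p) * indicator {0<..} (snd p)"
  have "?k \<in> borel_measurable ((borel :: 'a measure) \<Otimes>\<^sub>M lborel)"
    by measurable
  then have "(\<lambda>x. \<integral>\<^sup>+ r. ?k (x, r) \<partial>lborel) \<in> borel_measurable borel"
    by (rule lborel.borel_measurable_nn_integral_fst)
  moreover have "wolff_potential \<alpha> \<psi> f = (\<lambda>x. \<integral>\<^sup>+ r. ?k (x, r) \<partial>lborel)"
    by (rule ext) (simp only: wolff_potential_def nn_integral_completion fst_conv snd_conv)
  ultimately show ?thesis by simp
qed

section \<open>Averages over small balls\<close>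

lemma sum_strict_mono_ennreal:
  fixes f g :: "'a \<Rightarrow> ennreal"
  assumes "finite A" "A \<noteq> {}" "\<And>x. x \<in> A \<Longrightarrow> f x < g x"
  shows "sum f A < sum g A"
  using assms
proof (induction rule: finite_ne_induct)
  case (insert x F)
  then have "f x + sum f F < g x + sum g F" by (intro add_strict_mono) auto
  then show ?case using insert by simp
qed simp

text \<open>
  The weak-type estimate for the maximal function, obtained directly from \<open>h\<close> rather than by splitting
  \<open>h\<close>: a finite disjoint family of balls with averages above the mean of \<open>h\<^sup>*\<close> over \<open>(0,t)\<close>
  has total measure at most \<open>t\<close>, since that mean decreases in \<open>t\<close>.
\<close>

lemma averages_bounded_off_small_set:
  fixes h :: "'a::euclidean_space \<Rightarrow> ennreal"
  assumes h: "h \<in> borel_measurable lebesgue" and t: "0 < t"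
  obtains U where "U \<in> sets lebesgue" "emeasure lebesgue U \<le> ennreal (5 ^ DIM('a) * t)"
    "\<And>x r. x \<notin> U \<Longrightarrow> 0 < r \<Longrightarrow> r \<le> \<rho> \<Longrightarrow> (\<integral>\<^sup>+ y\<in>ball x r. h y \<partial>lebesgue)
       \<le> ennreal (unit_ball_vol DIM('a) * r ^ DIM('a)) * (ennreal (1 / t) * rearrangement_mass h t)"
proof -
  let ?vol = "\<lambda>r. unit_ball_vol DIM('a) * r ^ DIM('a)"
  let ?mean = "ennreal (1 / t) * rearrangement_mass h t"
  \<comment> \<open>The bad balls, as pairs of centre and radius; the bound \<rho> on the radii is
    what Vitali's lemma asks for.\<close>
  let ?K = "{p :: 'a \<times> real. 0 < snd p \<and> snd p \<le> \<rho>
    \<and> ennreal (?vol (snd p)) * ?mean < (\<integral>\<^sup>+ y\<in>ball (fst p) (snd p). h y \<partial>lebesgue)}"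
  have r: "0 < snd p \<and> snd p \<le> \<rho>" if "p \<in> ?K" for p using that by auto
  have "fst ` ?K \<subseteq> (\<Union>p\<in>?K. cball (fst p) (snd p))"
  proof
    fix x assume "x \<in> fst ` ?K"
    then obtain p where p: "x = fst p" "p \<in> ?K" by (rule imageE)
    then have "x \<in> cball (fst p) (snd p)" by simp
    with p(2) show "x \<in> (\<Union>p\<in>?K. cball (fst p) (snd p))" by (rule UN_I)
  qed
  from Vitali_covering_lemma_cballs[OF this r]
  obtain C where C: "countable C" "C \<subseteq> ?K"
    and disj: "pairwise (\<lambda>i j. disjnt (cball (fst i) (snd i)) (cball (fst j) (snd j))) C"
    and cover: "fst ` ?K \<subseteq> (\<Union>p\<in>C. cball (fst p) (5 * snd p))"
    by blast
  let ?U = "\<Union>p\<in>C. cball (fst p) (5 * snd p)"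
  have pos: "0 < snd p" if "p \<in> C" for p using that C(2) by auto
  have vol: "0 \<le> ?vol s" if "0 \<le> s" for s using that by simp
  \<comment> \<open>If the total volume V exceeded t, the strict inequalities in \<open>?K\<close>
    would add up to V mean < F(V), while F(V) \<le> (V/t) F(t) = V mean.\<close>
  have small: "(\<Sum>p\<in>I. ?vol (snd p)) \<le> t" if I: "I \<subseteq> C" "finite I" for I
  proof (rule ccontr)
    assume "\<not> ?thesis"
    then have V: "t < (\<Sum>p\<in>I. ?vol (snd p))" (is "_ < ?V") by simp
    then have "I \<noteq> {}" using t by auto
    have em: "emeasure lebesgue (ball (fst p) (snd p)) = ennreal (?vol (snd p))" if "p \<in> I" for p
      using pos[of p] that I by (auto simp: emeasure_ball)
    have d: "disjoint_family_on (\<lambda>p. ball (fst p) (snd p)) I"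
      unfolding disjoint_family_on_def
    proof (intro ballI impI)
      fix p q :: "'a \<times> real" assume "p \<in> I" "q \<in> I" "p \<noteq> q"
      then have "disjnt (cball (fst p) (snd p)) (cball (fst q) (snd q))"
        using I(1) by (intro pairwiseD[OF disj]) auto
      then show "ball (fst p) (snd p) \<inter> ball (fst q) (snd q) = {}"
        using ball_subset_cball[of "fst p" "snd p"] ball_subset_cball[of "fst q" "snd q"]
        unfolding disjnt_def by blast
    qed
    have "ennreal ?V * ?mean = (\<Sum>p\<in>I. ennreal (?vol (snd p)) * ?mean)"
      using pos I by (subst sum_ennreal[symmetric]) (auto simp: sum_distrib_right less_imp_le)
    also have "\<dots> < (\<Sum>p\<in>I. \<integral>\<^sup>+ y\<in>ball (fst p) (snd p). h y \<partial>lebesgue)"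
      using C(2) I by (intro sum_strict_mono_ennreal \<open>I \<noteq> {}\<close>) auto
    also have "\<dots> = (\<integral>\<^sup>+ y. (\<Sum>p\<in>I. h y * indicator (ball (fst p) (snd p)) y) \<partial>lebesgue)"
      using h by (intro nn_integral_sum[symmetric] borel_measurable_times_ennreal borel_measurable_indicator) simp_all
    also have "\<dots> = (\<integral>\<^sup>+ y\<in>(\<Union>p\<in>I. ball (fst p) (snd p)). h y \<partial>lebesgue)"
      by (simp only: indicator_UN_disjoint[OF I(2) d] sum_distrib_left)
    also have "\<dots> \<le> rearrangement_mass h ?V"
    proof (rule hardy_littlewood[OF h])
      have "(\<lambda>p. ball (fst p) (snd p)) ` I \<subseteq> sets lebesgue" by auto
      then have "emeasure lebesgue (\<Union>p\<in>I. ball (fst p) (snd p))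
          = (\<Sum>p\<in>I. emeasure lebesgue (ball (fst p) (snd p)))"
        using d I(2) by (rule sum_emeasure[symmetric])
      also have "\<dots> = (\<Sum>p\<in>I. ennreal (?vol (snd p)))"
        using em by (rule sum.cong[OF refl])
      also have "\<dots> = ennreal ?V"
        using pos I by (intro sum_ennreal) (auto simp: less_imp_le)
      finally show "emeasure lebesgue (\<Union>p\<in>I. ball (fst p) (snd p)) \<le> ennreal ?V" by simp
    qed (intro sets.finite_UN I(2), simp)
    also have "\<dots> \<le> ennreal (?V / t) * rearrangement_mass h t"
      using V t by (intro rearrangement_mass_scale[OF h]) auto
    also have "\<dots> = ennreal ?V * ?mean"
      using V t by (simp add: mult.assoc[symmetric] flip: ennreal_mult)
    finally show False by simp
  qed
  \<comment> \<open>Enlarging the radii 5 times multiplies volumes by 5^n. The bound is uniform over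
    finite subfamilies, so it passes to the countable union.\<close>
  have "measure lebesgue (\<Union>p\<in>I. cball (fst p) (5 * snd p)) \<le> 5 ^ DIM('a) * t"
    if I: "I \<subseteq> C" "finite I" for I
  proof -
    have "measure lebesgue (\<Union>p\<in>I. cball (fst p) (5 * snd p))
        \<le> (\<Sum>p\<in>I. measure lebesgue (cball (fst p) (5 * snd p)))"
      using I by (intro measure_UNION_le) auto
    also have "\<dots> = (\<Sum>p\<in>I. 5 ^ DIM('a) * ?vol (snd p))"
    proof (rule sum.cong[OF refl])
      fix p assume "p \<in> I"
      then have "0 < snd p" using pos I(1) by blast
      then show "measure lebesgue (cball (fst p) (5 * snd p)) = 5 ^ DIM('a) * ?vol (snd p)"
        by (simp add: content_cball power_mult_distrib)
    qed
    also have "\<dots> \<le> 5 ^ DIM('a) * t"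
      using small[OF I] by (simp flip: sum_distrib_left)
    finally show ?thesis .
  qed
  then have U: "?U \<in> fmeasurable lebesgue" "measure lebesgue ?U \<le> 5 ^ DIM('a) * t"
    using fmeasurable_UN_bound[OF C(1), of "\<lambda>p. cball (fst p) (5 * snd p)" lebesgue]
      measure_UN_bound[OF C(1), of "\<lambda>p. cball (fst p) (5 * snd p)" lebesgue]
    by (auto simp: lmeasurable_cball)
  show thesis
  proof
    show "?U \<in> sets lebesgue" using U by auto
    show "emeasure lebesgue ?U \<le> ennreal (5 ^ DIM('a) * t)"
      using U t by (simp add: emeasure_eq_measure2 ennreal_leI)
    fix x and r :: real assume "x \<notin> ?U" "0 < r" "r \<le> \<rho>"
    \<comment> \<open>The enlarged balls cover all centres of bad balls, so a point off
      \<open>?U\<close> is not such a centre.\<close>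
    have "(x, r) \<notin> ?K"
    proof
      assume "(x, r) \<in> ?K"
      from subsetD[OF cover imageI[OF this]] have "x \<in> ?U" by simp
      with \<open>x \<notin> ?U\<close> show False by (rule notE)
    qed
    then show "(\<integral>\<^sup>+ y\<in>ball x r. h y \<partial>lebesgue) \<le> ennreal (?vol r) * ?mean"
      using \<open>0 < r\<close> \<open>r \<le> \<rho>\<close> by (auto simp: not_less)
  qed
qed

section \<open>Integrals in the radius and their form in the volume variable\<close>

text \<open>For a < 1 the integrand is singular at 0, so the fundamental theorem is applied with the
  derivative in the interior only and the primitive r^a/a continuous up to the endpoints.\<close>

lemma nn_integral_powr_from_0:
  fixes a b :: real
  assumes "0 < a" "0 \<le> b"
  shows "(\<integral>\<^sup>+ r\<in>{0..b}. ennreal (r powr (a - 1)) \<partial>lborel) = ennreal (b powr a / a)"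
proof (rule nn_integral_has_integral_lebesgue')
  have "((\<lambda>r. r powr (a - 1)) has_integral b powr a / a - 0 powr a / a) {0..b}"
  proof (rule fundamental_theorem_of_calculus_interior)
    show "continuous_on {0..b} (\<lambda>r. r powr a / a)"
      using assms by (intro continuous_on_divide continuous_on_powr' continuous_on_id continuous_on_const) auto
    fix r assume "r \<in> {0<..<b}"
    then show "((\<lambda>r. r powr a / a) has_vector_derivative r powr (a - 1)) (at r)"
      using assms unfolding has_real_derivative_iff_has_vector_derivative[symmetric]
      by (auto intro!: derivative_eq_intros simp: powr_diff)
  qed (use assms in simp)
  then show "((\<lambda>r. r powr (a - 1)) has_integral b powr a / a) {0..b}" by simp
qed simp

text \<open>The substitution is r = c s^(1/n). The factor k c^n is left general: it is 1 in the
  upper bound and 2 in the lower bound.\<close>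

lemma wolff_tail_substitution:
  fixes \<Psi> :: "ennreal \<Rightarrow> ennreal" and F :: "real \<Rightarrow> ennreal" and n :: nat and \<alpha> :: real
  assumes [measurable]: "\<Psi> \<in> borel_measurable borel" "F \<in> borel_measurable borel"
    and c: "0 < c" and n: "0 < n" and t: "0 < t"
  shows "(\<integral>\<^sup>+ r\<in>{c * t powr (1 / n)<..}. ennreal (r powr (\<alpha> - 1)) *
        \<Psi> (ennreal (r powr (\<alpha> - n)) * F (k * r ^ n)) \<partial>lborel)
    = ennreal (c powr \<alpha> / n) * (\<integral>\<^sup>+ s\<in>{t<..}. ennreal (s powr (\<alpha> / n - 1)) *
        \<Psi> (ennreal (c powr (\<alpha> - n) * s powr (\<alpha> / n - 1)) * F (k * c ^ n * s)) \<partial>lborel)"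
proof -
  let ?G = "\<lambda>r. ennreal (r powr (\<alpha> - 1)) * \<Psi> (ennreal (r powr (\<alpha> - n)) * F (k * r ^ n))"
  let ?H = "\<lambda>s. ennreal (s powr (\<alpha> / n - 1)) *
        \<Psi> (ennreal (c powr (\<alpha> - n) * s powr (\<alpha> / n - 1)) * F (k * c ^ n * s))"
  have pw: "ennreal (c * (1 / n) * s powr (1 / n - 1)) * ?G (c * s powr (1 / n))
      = ennreal (c powr \<alpha> / n) * ?H s" if s: "0 < s" for s
  proof -
    have e1: "(c * s powr (1 / n)) powr (\<alpha> - n) = c powr (\<alpha> - n) * s powr (\<alpha> / n - 1)"
      using c s n by (simp add: powr_mult powr_powr diff_divide_distrib)
    \<comment> \<open>Jacobian times the weight r^(\<alpha>-1); the powers of c combine to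
      c^\<alpha>.\<close>
    have "c * (1 / n) * s powr (1 / n - 1) * (c * s powr (1 / n)) powr (\<alpha> - 1)
        = (c * c powr (\<alpha> - 1) / n) * (s powr (1 / n - 1) * s powr ((\<alpha> - 1) / n))"
      using c s n by (simp add: powr_mult powr_powr)
    also have "c * c powr (\<alpha> - 1) = c powr \<alpha>"
      using c by (simp add: powr_mult_base)
    also have "s powr (1 / n - 1) * s powr ((\<alpha> - 1) / n) = s powr (\<alpha> / n - 1)"
      by (simp add: powr_add[symmetric] diff_divide_distrib)
    finally have e2: "c * (1 / n) * s powr (1 / n - 1) * (c * s powr (1 / n)) powr (\<alpha> - 1)
        = (c powr \<alpha> / n) * s powr (\<alpha> / n - 1)" .
    have "(s powr (1 / n)) ^ n = s"
      using s n by (simp add: powr_powr flip: powr_realpow)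
    then have e3: "k * (c * s powr (1 / n)) ^ n = k * c ^ n * s"
      by (simp add: power_mult_distrib)
    have "ennreal (c * (1 / n) * s powr (1 / n - 1)) * ?G (c * s powr (1 / n))
       = ennreal (c * (1 / n) * s powr (1 / n - 1) * (c * s powr (1 / n)) powr (\<alpha> - 1))
         * \<Psi> (ennreal ((c * s powr (1 / n)) powr (\<alpha> - n)) * F (k * (c * s powr (1 / n)) ^ n))"
      using c n by (subst ennreal_mult) (simp_all add: mult.assoc)
    also have "\<dots> = ennreal (c powr \<alpha> / n) * ?H s"
      unfolding e1 e2 e3 by (subst ennreal_mult) (simp_all add: mult.assoc)
    finally show ?thesis .
  qed
  have "(\<integral>\<^sup>+ r\<in>{c * t powr (1 / n)<..}. ?G r \<partial>lborel)
      = (\<integral>\<^sup>+ s\<in>{t<..}. ennreal (c * (1 / n) * s powr (1 / n - 1)) * ?G (c * s powr (1 / n)) \<partial>lborel)"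
    using c n t by (intro nn_integral_powr_substitution) simp_all
  also have "\<dots> = (\<integral>\<^sup>+ s. ennreal (c powr \<alpha> / n) * (?H s * indicator {t<..} s) \<partial>lborel)"
  proof (rule nn_integral_cong)
    fix s :: real
    show "ennreal (c * (1 / n) * s powr (1 / n - 1)) * ?G (c * s powr (1 / n)) * indicator {t<..} s
        = ennreal (c powr \<alpha> / n) * (?H s * indicator {t<..} s)"
      using pw[of s] t by (cases "t < s") (simp_all add: mult.assoc)
  qed
  also have "\<dots> = ennreal (c powr \<alpha> / n) * (\<integral>\<^sup>+ s\<in>{t<..}. ?H s \<partial>lborel)"
    by (rule nn_integral_cmult) measurable
  finally show ?thesis .
qed

text \<open>The factor 1/s in the average lowers the exponent by one. This passes from the form in
  the theorem to the form with F that the substitution yields.\<close>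

lemma maximal_rearrangement_weighted:
  assumes "h \<in> borel_measurable lebesgue" and s: "0 < s" and C: "0 \<le> C"
  shows "ennreal (C * s powr b) * maximal_rearrangement h s
    = ennreal (C * s powr (b - 1)) * rearrangement_mass h s"
proof -
  have "ennreal (C * s powr b) * ennreal (1 / s) = ennreal (C * s powr (b - 1))"
    using s C by (simp add: powr_diff flip: ennreal_mult)
  then show ?thesis
    by (simp add: maximal_rearrangement_eq[OF assms(1)] mult.assoc[symmetric])
qed

section \<open>The two bounds\<close>

text \<open>The integral common to both bounds; \<open>C\<close> takes the place of C_2 or
  C_4.\<close>

definition rearranged_wolff ::
  "real \<Rightarrow> (real \<Rightarrow> real) \<Rightarrow> real \<Rightarrow> ('a::euclidean_space \<Rightarrow> real) \<Rightarrow> real \<Rightarrow> ennreal" where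
  "rearranged_wolff \<alpha> \<psi> C f t =
    (\<integral>\<^sup>+ s\<in>{t<..}. ennreal (s powr (\<alpha> / DIM('a) - 1)) *
      extend_profile \<psi> (ennreal (C * s powr (\<alpha> / DIM('a))) *
        maximal_rearrangement (\<lambda>x. ennreal \<bar>f x\<bar>) s) \<partial>lebesgue)"

text \<open>The normalisation says |B(0, c/2)| = 2. With r = c s^(1/n), the ball of radius r/2 then
  has volume 2s, and r > 2\<rho> means s > t.\<close>

lemma wolff_lower_bound:
  fixes f :: "'a::euclidean_space \<Rightarrow> real"
  assumes \<psi>: "mono_on {0..} \<psi>" and f: "f \<in> borel_measurable lebesgue"
    and nonneg: "\<And>x. 0 \<le> f x" and rad: "radially_decreasing f"
    and c: "0 < c" "unit_ball_vol DIM('a) * (c / 2) ^ DIM('a) = 2" and t: "0 < t"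
  shows "ennreal (c powr \<alpha> / DIM('a)) * rearranged_wolff \<alpha> \<psi> (c powr (\<alpha> - DIM('a))) f t
    \<le> decreasing_rearrangement (wolff_potential \<alpha> \<psi> f) t"
proof -
  let ?n = "DIM('a)" and ?w = "unit_ball_vol DIM('a)" and ?h = "\<lambda>x. ennreal \<bar>f x\<bar>"
  let ?\<Psi> = "extend_profile \<psi>" and ?F = "rearrangement_mass ?h"
  let ?W = "wolff_potential \<alpha> \<psi> f"
  let ?L = "ennreal (c powr \<alpha> / ?n) * rearranged_wolff \<alpha> \<psi> (c powr (\<alpha> - ?n)) f t"
  define \<rho> where "\<rho> = c / 2 * t powr (1 / ?n)"
  have \<rho>: "0 < \<rho>" using c t by (simp add: \<rho>_def)
  have h: "?h \<in> borel_measurable lebesgue" using f by measurable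
  have \<Psi>: "mono ?\<Psi>" by (rule mono_extend_profile[OF \<psi>])
  have F_meas: "?F \<in> borel_measurable borel"
    by (rule borel_measurable_monotone_real) (simp add: rearrangement_mass_mono monoI)
  have bound: "?L \<le> ?W x" if x: "x \<in> ball 0 \<rho>" for x
  proof -
    have "?L \<le> ennreal (c powr \<alpha> / ?n) * (\<integral>\<^sup>+ s\<in>{t<..}. ennreal (s powr (\<alpha> / ?n - 1)) *
        ?\<Psi> (ennreal (c powr (\<alpha> - ?n) * s powr (\<alpha> / ?n - 1)) * ?F (?w / 2 ^ ?n * c ^ ?n * s)) \<partial>lborel)"
      unfolding rearranged_wolff_def nn_integral_completion
    proof (intro mult_left_mono nn_integral_mono, goal_cases)
      case (1 s)
      show ?case
      proof (cases "t < s")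
        case True
        then have s: "0 < s" using t by simp
        \<comment> \<open>The volume of the half ball is 2s; the surplus is given away by
          monotonicity of F.\<close>
        have "?w / 2 ^ ?n * c ^ ?n * s = 2 * s"
          using c(2) by (simp add: power_divide)
        then have "?F s \<le> ?F (?w / 2 ^ ?n * c ^ ?n * s)"
          using s by (intro rearrangement_mass_mono) simp
        then have "?\<Psi> (ennreal (c powr (\<alpha> - ?n) * s powr (\<alpha> / ?n)) * maximal_rearrangement ?h s)
          \<le> ?\<Psi> (ennreal (c powr (\<alpha> - ?n) * s powr (\<alpha> / ?n - 1)) * ?F (?w / 2 ^ ?n * c ^ ?n * s))"
          unfolding maximal_rearrangement_weighted[OF h s powr_ge_zero]
          by (intro monoD[OF \<Psi>] mult_left_mono) simp_all
        then show ?thesis by (intro mult_right_mono mult_left_mono) simp_all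
      qed simp
    qed simp
    also have "\<dots> = (\<integral>\<^sup>+ r\<in>{c * t powr (1 / ?n)<..}. ennreal (r powr (\<alpha> - 1)) *
        ?\<Psi> (ennreal (r powr (\<alpha> - ?n)) * ?F (?w / 2 ^ ?n * r ^ ?n)) \<partial>lborel)"
      using c t by (intro wolff_tail_substitution[symmetric] borel_measurable_mono_ennreal \<Psi> F_meas) simp_all
    also have "\<dots> \<le> ?W x"
      unfolding wolff_potential_def nn_integral_completion[of _ "\<lambda>r. _ r * indicator {0<..} r"]
    proof (intro nn_integral_mono)
      fix r :: real
      show "ennreal (r powr (\<alpha> - 1)) * ?\<Psi> (ennreal (r powr (\<alpha> - ?n)) * ?F (?w / 2 ^ ?n * r ^ ?n))
            * indicator {c * t powr (1 / ?n)<..} r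
        \<le> ennreal (r powr (\<alpha> - 1)) * ?\<Psi> (ennreal (r powr (\<alpha> - ?n)) * (\<integral>\<^sup>+ y\<in>ball x r. ?h y \<partial>lebesgue))
            * indicator {0<..} r"
      proof (cases "c * t powr (1 / ?n) < r")
        case True
        then have r: "2 * \<rho> < r" by (simp add: \<rho>_def)
        then have "0 < r" using \<rho> by simp
        have "?F (?w / 2 ^ ?n * r ^ ?n) = (\<integral>\<^sup>+ y\<in>ball 0 (r / 2). ?h y \<partial>lebesgue)"
          using radially_decreasing_mass[OF rad nonneg f, of "r / 2"] \<open>0 < r\<close> by (simp add: power_divide)
        also have "\<dots> \<le> (\<integral>\<^sup>+ y\<in>ball x r. ?h y \<partial>lebesgue)"
        proof (intro nn_integral_mono mult_left_mono)
          have "ball 0 (r / 2) \<subseteq> ball x r"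
          proof
            fix y :: 'a assume "y \<in> ball 0 (r / 2)"
            then have "norm x < r / 2" "norm y < r / 2" using x r by auto
            then show "y \<in> ball x r" using norm_triangle_ineq4[of x y] by (simp add: dist_norm)
          qed
          then show "indicator (ball 0 (r / 2)) y \<le> (indicator (ball x r) y :: ennreal)" for y
            by (auto split: split_indicator)
        qed simp
        finally have "?\<Psi> (ennreal (r powr (\<alpha> - ?n)) * ?F (?w / 2 ^ ?n * r ^ ?n))
          \<le> ?\<Psi> (ennreal (r powr (\<alpha> - ?n)) * (\<integral>\<^sup>+ y\<in>ball x r. ?h y \<partial>lebesgue))"
          by (intro monoD[OF \<Psi>] mult_left_mono) simp_all
        then show ?thesis
          using True \<open>0 < r\<close> by (simp add: mult_left_mono)
      qed simp
    qed
    finally show ?thesis .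
  qed
  show ?thesis
  \<comment> \<open>The rearrangement uses strict superlevel sets at finite levels, so the bound is
    approached by y < \<open>?L\<close>: then the whole ball lies in {W > y}. Its measure 2t exceeds
    t strictly, as the definition demands.\<close>
  proof (rule dense_le)
    fix y assume y: "y < ?L"
    then have "y < top" using less_top order_less_le_trans top_greatest by blast
    then obtain s where s: "0 \<le> s" "y = ennreal s" by (cases y) auto
    have "?W \<in> borel_measurable borel"
      by (rule borel_measurable_wolff_potential[OF f \<psi>])
    then have "{x \<in> space borel. y < ?W x} \<in> sets borel" by measurable
    then have "{x. y < ?W x} \<in> sets lebesgue" by (simp add: sets_completionI_sets)
    moreover have "ball 0 \<rho> \<subseteq> {x. y < ?W x}"
      using bound y by (auto intro: less_le_trans)
    ultimately have "emeasure lebesgue (ball (0::'a) \<rho>) \<le> emeasure lebesgue {x. y < ?W x}"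
      by (intro emeasure_mono)
    moreover have "emeasure lebesgue (ball (0::'a) \<rho>) = ennreal (2 * t)"
    proof -
      have "(t powr (1 / ?n)) ^ ?n = t"
        using t by (simp add: powr_powr flip: powr_realpow)
      then have "?w * \<rho> ^ ?n = 2 * t"
        using c(2) unfolding \<rho>_def power_mult_distrib by (metis mult.assoc)
      then show ?thesis using \<rho> by (simp add: emeasure_ball)
    qed
    moreover have "ennreal t < ennreal (2 * t)" using t by (simp add: ennreal_less_iff)
    ultimately have "ennreal t < emeasure lebesgue {x. ?W x > ennreal s}"
      unfolding s by (metis less_le_trans)
    then show "y \<le> decreasing_rearrangement ?W t"
      unfolding decreasing_rearrangement_def s(2) using s(1) by (intro Sup_upper) blast
  qed
qed

text \<open>A level above K has its superlevel set inside U, of measure at most t, and so does not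
  enter the supremum.\<close>

lemma decreasing_rearrangement_leI:
  assumes "U \<in> sets lebesgue" "emeasure lebesgue U \<le> ennreal t" "\<And>x. x \<notin> U \<Longrightarrow> h x \<le> K"
  shows "decreasing_rearrangement h t \<le> K"
  unfolding decreasing_rearrangement_def
proof (rule Sup_least, safe, rule ccontr)
  fix s assume s: "ennreal t < emeasure lebesgue {x. ennreal s < h x}" "\<not> ennreal s \<le> K"
  have "{x. ennreal s < h x} \<subseteq> U"
  proof (rule subsetI, rule ccontr)
    fix x assume "x \<in> {x. ennreal s < h x}" "x \<notin> U"
    then show False using assms(3)[of x] s(2) by simp
  qed
  from emeasure_mono[OF this assms(1)] assms(2) s(1) show False by simp
qed

text \<open>The normalisation says |B(0, c)| = 1. In the outer constant, c^\<alpha>/n comes from the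
  substitution for large radii and 2 c^\<alpha>/\<alpha> from small radii. In the inner constant,
  5^n comes from Vitali and 2 from the comparison on (t, 2t].\<close>

lemma wolff_upper_bound:
  fixes f :: "'a::euclidean_space \<Rightarrow> real" and \<alpha> :: real
  assumes \<alpha>: "0 < \<alpha>" "\<alpha> < DIM('a)" and \<psi>: "mono_on {0..} \<psi>" and f: "f \<in> borel_measurable lebesgue"
    and c: "0 < c" "unit_ball_vol DIM('a) * c ^ DIM('a) = 1" and t: "0 < t"
  shows "decreasing_rearrangement (wolff_potential \<alpha> \<psi> f) t
    \<le> ennreal (2 * c powr \<alpha> / \<alpha> + c powr \<alpha> / DIM('a))
      * rearranged_wolff \<alpha> \<psi> (2 * 5 ^ DIM('a) * c powr (\<alpha> - DIM('a))) f t"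
proof -
  let ?n = "DIM('a)" and ?w = "unit_ball_vol DIM('a)" and ?h = "\<lambda>x. ennreal \<bar>f x\<bar>"
  let ?\<Psi> = "extend_profile \<psi>" and ?F = "rearrangement_mass ?h"
  let ?W = "wolff_potential \<alpha> \<psi> f"
  let ?b = "5 ^ ?n * c powr (\<alpha> - ?n)"
  let ?J = "rearranged_wolff \<alpha> \<psi> (2 * 5 ^ ?n * c powr (\<alpha> - ?n)) f t"
  let ?I = "\<lambda>x r. \<integral>\<^sup>+ y\<in>ball x r. ?h y \<partial>lebesgue"
  define \<rho> where "\<rho> = c * t powr (1 / ?n)"
  \<comment> \<open>A bound for the profile at all radii up to \<rho>, valid off the exceptional
    set.\<close>
  define K where "K = ?\<Psi> (ennreal (?b * t powr (\<alpha> / ?n - 1)) * ?F t)"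
  have \<rho>: "0 < \<rho>" using c t by (simp add: \<rho>_def)
  have h: "?h \<in> borel_measurable lebesgue" using f by measurable
  have \<Psi>: "mono ?\<Psi>" by (rule mono_extend_profile[OF \<psi>])
  have F_meas: "?F \<in> borel_measurable borel"
    by (rule borel_measurable_monotone_real) (simp add: rearrangement_mass_mono monoI)
  note [measurable] = F_meas borel_measurable_mono_ennreal[OF \<Psi>]
  have J_eq: "?J = (\<integral>\<^sup>+ s\<in>{t<..}. ennreal (s powr (\<alpha> / ?n - 1)) *
      ?\<Psi> (ennreal (2 * ?b * s powr (\<alpha> / ?n - 1)) * ?F s) \<partial>lborel)"
    unfolding rearranged_wolff_def nn_integral_completion
  proof (rule nn_integral_cong, goal_cases)
    case (1 s)
    have "0 \<le> 2 * 5 ^ ?n * c powr (\<alpha> - ?n)" by simp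
    then show ?case
      using maximal_rearrangement_weighted[OF h, of s "2 * 5 ^ ?n * c powr (\<alpha> - ?n)" "\<alpha> / ?n"] t
      by (cases "t < s") (simp_all add: mult.assoc)
  qed
  \<comment> \<open>Averages are compared with the mean over (0, t/5^n), so that the exceptional set
    has measure at most t.\<close>
  have tp: "0 < t / 5 ^ ?n" using t by simp
  obtain U where U: "U \<in> sets lebesgue" "emeasure lebesgue U \<le> ennreal (5 ^ ?n * (t / 5 ^ ?n))"
    and avg: "\<And>x r. x \<notin> U \<Longrightarrow> 0 < r \<Longrightarrow> r \<le> \<rho> \<Longrightarrow>
      ?I x r \<le> ennreal (?w * r ^ ?n) * (ennreal (1 / (t / 5 ^ ?n)) * ?F (t / 5 ^ ?n))"
    by (rule averages_bounded_off_small_set[OF h tp, where \<rho> = \<rho>]) (rule that; assumption)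
  have w: "?w = c powr (- real ?n)"
    using c by (simp add: powr_minus powr_realpow divide_simps)
  have \<rho>\<alpha>: "\<rho> powr \<alpha> = c powr \<alpha> * t powr (\<alpha> / ?n)"
    using c t by (simp add: \<rho>_def powr_mult powr_powr)
  have ennreal_assoc: "ennreal x * (ennreal y * (ennreal z * X)) = ennreal (x * y * z) * X"
    if "0 \<le> x" "0 \<le> y" "0 \<le> z" for x y z X
    using that by (simp add: ennreal_mult mult.assoc)
  have near: "?\<Psi> (ennreal (r powr (\<alpha> - ?n)) * ?I x r) \<le> K" if "x \<notin> U" "0 < r" "r \<le> \<rho>" for x r
    unfolding K_def
  proof (rule monoD[OF \<Psi>])
    have Ft: "?F (t / 5 ^ ?n) \<le> ?F t"
      using t by (intro rearrangement_mass_mono) (simp add: divide_le_eq)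
    \<comment> \<open>The ball volume cancels r^(-n), leaving r^\<alpha> \<le> \<rho>^\<alpha>; this
      makes the bound uniform in r.\<close>
    have "r powr (\<alpha> - ?n) * (?w * r ^ ?n) * (1 / (t / 5 ^ ?n)) = ?w * 5 ^ ?n / t * r powr \<alpha>"
      using that by (simp add: powr_diff powr_realpow)
    also have "\<dots> \<le> ?w * 5 ^ ?n / t * \<rho> powr \<alpha>"
      using that \<alpha> t by (intro mult_left_mono powr_mono2) simp_all
    also have "\<dots> = ?b * t powr (\<alpha> / ?n - 1)"
    proof -
      have "c powr (- real ?n) * c powr \<alpha> = c powr (\<alpha> - ?n)"
        by (simp flip: powr_add)
      moreover have "t powr (\<alpha> / ?n) / t = t powr (\<alpha> / ?n - 1)"
        using t by (simp add: powr_diff)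
      moreover have "?w * 5 ^ ?n / t * \<rho> powr \<alpha>
          = 5 ^ ?n * (c powr (- real ?n) * c powr \<alpha>) * (t powr (\<alpha> / ?n) / t)"
        unfolding w \<rho>\<alpha> by simp
      ultimately show ?thesis by simp
    qed
    finally have le: "r powr (\<alpha> - ?n) * (?w * r ^ ?n) * (1 / (t / 5 ^ ?n)) \<le> ?b * t powr (\<alpha> / ?n - 1)" .
    have "ennreal (r powr (\<alpha> - ?n)) * ?I x r \<le> ennreal (r powr (\<alpha> - ?n)) *
        (ennreal (?w * r ^ ?n) * (ennreal (1 / (t / 5 ^ ?n)) * ?F (t / 5 ^ ?n)))"
      using avg[OF that] by (rule mult_left_mono) simp
    also have "\<dots> = ennreal (r powr (\<alpha> - ?n) * (?w * r ^ ?n) * (1 / (t / 5 ^ ?n))) * ?F (t / 5 ^ ?n)"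
      using that t by (intro ennreal_assoc) simp_all
    also have "\<dots> \<le> ennreal (?b * t powr (\<alpha> / ?n - 1)) * ?F t"
      by (rule mult_mono[OF ennreal_leI[OF le] Ft]) simp_all
    finally show "ennreal (r powr (\<alpha> - ?n)) * ?I x r \<le> ennreal (?b * t powr (\<alpha> / ?n - 1)) * ?F t" .
  qed
  \<comment> \<open>Only (t, 2t] is kept from the integral. There the weight is at least its value
    at 2t, since \<alpha>/n - 1 < 0, and the profile is at least K.\<close>
  have K: "ennreal (t powr (\<alpha> / ?n) / 2) * K \<le> ?J"
  proof -
    have "t powr (\<alpha> / ?n) / 2 \<le> (2 * t) powr (\<alpha> / ?n - 1) * t"
    proof -
      have "(2 * t) powr (\<alpha> / ?n - 1) * t = 2 powr (\<alpha> / ?n) / 2 * t powr (\<alpha> / ?n)"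
        using t by (simp add: powr_mult powr_diff)
      moreover have "1 \<le> 2 powr (\<alpha> / ?n)" using \<alpha> by (intro ge_one_powr_ge_zero) simp_all
      ultimately show ?thesis
        using mult_right_mono[of 1 "2 powr (\<alpha> / ?n)" "t powr (\<alpha> / ?n)"] by simp
    qed
    then have "ennreal (t powr (\<alpha> / ?n) / 2) * K \<le> ennreal ((2 * t) powr (\<alpha> / ?n - 1) * t) * K"
      by (intro mult_right_mono ennreal_leI) simp_all
    also have "\<dots> = (ennreal ((2 * t) powr (\<alpha> / ?n - 1)) * K) * emeasure lborel {t<..2 * t}"
      using t by (simp add: ennreal_mult mult_ac)
    also have "\<dots> = (\<integral>\<^sup>+ s. ennreal ((2 * t) powr (\<alpha> / ?n - 1)) * K * indicator {t<..2 * t} s \<partial>lborel)"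
      by (rule nn_integral_cmult_indicator[symmetric]) simp
    also have "\<dots> \<le> ?J"
      unfolding J_eq
    proof (rule nn_integral_mono)
      fix s :: real
      show "ennreal ((2 * t) powr (\<alpha> / ?n - 1)) * K * indicator {t<..2 * t} s
        \<le> ennreal (s powr (\<alpha> / ?n - 1)) * ?\<Psi> (ennreal (2 * ?b * s powr (\<alpha> / ?n - 1)) * ?F s) * indicator {t<..} s"
      proof (cases "s \<in> {t<..2 * t}")
        case True
        then have s: "t < s" "s \<le> 2 * t" "0 < s" using t by auto
        have "(2 * t) powr (\<alpha> / ?n - 1) \<le> s powr (\<alpha> / ?n - 1)"
          using s \<alpha> by (intro powr_mono2') simp_all
        moreover have "K \<le> ?\<Psi> (ennreal (2 * ?b * s powr (\<alpha> / ?n - 1)) * ?F s)"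
          unfolding K_def
        proof (rule monoD[OF \<Psi>], rule mult_mono, rule ennreal_leI)
          \<comment> \<open>The exponent is negative, so passing from t to s costs a factor; s \<le>
            2t bounds it by 2.\<close>
          have "t powr (\<alpha> / ?n - 1) = t powr (\<alpha> / ?n) / t" using t by (simp add: powr_diff)
          also have "\<dots> \<le> s powr (\<alpha> / ?n) / t"
            using s t \<alpha> by (intro divide_right_mono powr_mono2) simp_all
          also have "\<dots> \<le> s powr (\<alpha> / ?n) / (s / 2)"
            using s t by (intro divide_left_mono) simp_all
          also have "\<dots> = 2 * s powr (\<alpha> / ?n - 1)" using s by (simp add: powr_diff)
          finally have "?b * t powr (\<alpha> / ?n - 1) \<le> ?b * (2 * s powr (\<alpha> / ?n - 1))"
            by (rule mult_left_mono) simp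
          then show "?b * t powr (\<alpha> / ?n - 1) \<le> 2 * ?b * s powr (\<alpha> / ?n - 1)" by (simp add: mult_ac)
          show "?F t \<le> ?F s" using s by (intro rearrangement_mass_mono) simp
        qed simp_all
        ultimately show ?thesis using s by (auto intro!: mult_mono ennreal_leI)
      qed simp
    qed
    finally show ?thesis .
  qed
  have "?W x \<le> ennreal (2 * c powr \<alpha> / \<alpha> + c powr \<alpha> / ?n) * ?J" if x: "x \<notin> U" for x
  proof -
    let ?g = "\<lambda>r. ennreal (r powr (\<alpha> - 1)) * ?\<Psi> (ennreal (r powr (\<alpha> - ?n)) * ?F (?w * r ^ ?n))
      * indicator {c * t powr (1 / ?n)<..} r"
    \<comment> \<open>Split at \<rho>: the bound K for small radii, \<open>hardy_littlewood\<close>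
      for large ones.\<close>
    have "?W x \<le> (\<integral>\<^sup>+ r. K * (ennreal (r powr (\<alpha> - 1)) * indicator {0..\<rho>} r) + ?g r \<partial>lborel)"
      unfolding wolff_potential_def nn_integral_completion[of _ "\<lambda>r. _ r * indicator {0<..} r"]
    proof (rule nn_integral_mono)
      fix r :: real
      show "ennreal (r powr (\<alpha> - 1)) * ?\<Psi> (ennreal (r powr (\<alpha> - ?n)) * ?I x r) * indicator {0<..} r
        \<le> K * (ennreal (r powr (\<alpha> - 1)) * indicator {0..\<rho>} r) + ?g r"
      proof -
        consider "r \<le> 0" | "0 < r" "r \<le> \<rho>" | "0 < r" "\<rho> < r" by linarith
        then show ?thesis
        proof cases
          case 2
          then show ?thesis
            using mult_left_mono[OF near[OF x 2], of "ennreal (r powr (\<alpha> - 1))"]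
            by (simp add: \<rho>_def mult.commute)
        next
          case 3
          have "?I x r \<le> ?F (?w * r ^ ?n)"
            using 3 by (intro hardy_littlewood[OF h]) (simp_all add: emeasure_ball)
          then have "?\<Psi> (ennreal (r powr (\<alpha> - ?n)) * ?I x r)
              \<le> ?\<Psi> (ennreal (r powr (\<alpha> - ?n)) * ?F (?w * r ^ ?n))"
            by (intro monoD[OF \<Psi>] mult_left_mono) simp_all
          then show ?thesis using 3 by (simp add: \<rho>_def mult_left_mono)
        qed simp
      qed
    qed
    also have "\<dots> = K * ennreal (\<rho> powr \<alpha> / \<alpha>) + (\<integral>\<^sup>+ r. ?g r \<partial>lborel)"
      using \<alpha> \<rho> by (simp add: nn_integral_add nn_integral_cmult nn_integral_powr_from_0)
    also have "(\<integral>\<^sup>+ r. ?g r \<partial>lborel) = ennreal (c powr \<alpha> / ?n) * (\<integral>\<^sup>+ s\<in>{t<..}. ennreal (s powr (\<alpha> / ?n - 1)) *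
        ?\<Psi> (ennreal (c powr (\<alpha> - ?n) * s powr (\<alpha> / ?n - 1)) * ?F (?w * c ^ ?n * s)) \<partial>lborel)"
      using c t by (intro wolff_tail_substitution) simp_all
    \<comment> \<open>Since w c^n = 1, the argument of F is s itself; only the constant inside the
      profile is enlarged.\<close>
    also have "\<dots> \<le> ennreal (c powr \<alpha> / ?n) * ?J"
      unfolding J_eq
    proof (rule mult_left_mono[OF nn_integral_mono], rule mult_right_mono, rule mult_left_mono,
        rule monoD[OF \<Psi>], rule mult_mono, rule ennreal_leI)
      fix s :: real
      have "(1::real) \<le> 5 ^ ?n" by (rule one_le_power) simp
      then have "(1::real) \<le> 2 * 5 ^ ?n" by linarith
      then show "c powr (\<alpha> - ?n) * s powr (\<alpha> / ?n - 1) \<le> 2 * ?b * s powr (\<alpha> / ?n - 1)"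
        using mult_right_mono[of 1 "2 * 5 ^ ?n" "c powr (\<alpha> - ?n)"] by (intro mult_right_mono) simp_all
      show "?F (?w * c ^ ?n * s) \<le> ?F s" by (simp add: c)
    qed simp_all
    \<comment> \<open>Rewritten to isolate t^(\<alpha>/n) K / 2, the quantity already bounded by
      \<open>?J\<close>.\<close>
    also have "K * ennreal (\<rho> powr \<alpha> / \<alpha>) = ennreal (2 * c powr \<alpha> / \<alpha>) * (ennreal (t powr (\<alpha> / ?n) / 2) * K)"
    proof -
      have "ennreal (\<rho> powr \<alpha> / \<alpha>) = ennreal (2 * c powr \<alpha> / \<alpha> * (t powr (\<alpha> / ?n) / 2))"
        by (simp add: \<rho>\<alpha>)
      also have "\<dots> = ennreal (2 * c powr \<alpha> / \<alpha>) * ennreal (t powr (\<alpha> / ?n) / 2)"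
        using \<alpha> by (intro ennreal_mult) simp_all
      finally show ?thesis by (simp only: mult_ac)
    qed
    also have "\<dots> \<le> ennreal (2 * c powr \<alpha> / \<alpha>) * ?J"
      using K by (rule mult_left_mono) simp
    also have "ennreal (2 * c powr \<alpha> / \<alpha>) * ?J + ennreal (c powr \<alpha> / ?n) * ?J
        = ennreal (2 * c powr \<alpha> / \<alpha> + c powr \<alpha> / ?n) * ?J"
      using \<alpha> by (simp add: distrib_right)
    finally show ?thesis by simp
  qed
  then show ?thesis
    using decreasing_rearrangement_leI[OF U(1)] U(2) by simp
qed

text \<open>The two bounds are instantiated with radii fixed by ball volumes alone, so the constants
  depend only on \<alpha> and the dimension and are chosen before \<psi>, t and f.\<close>

theorem theorem1:
  fixes \<alpha> :: real
  assumes "0 < \<alpha>" and "\<alpha> < real CARD('n::finite)"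
  shows
    "(\<exists>C1>0. \<exists>C2>0. \<forall>\<psi>::real \<Rightarrow> real.
        \<psi> \<in> {0..} \<rightarrow> {0..} \<longrightarrow> mono_on {0..} \<psi> \<longrightarrow> (\<forall>s>0. continuous (at_left s) \<psi>) \<longrightarrow>
        (\<forall>t>0. \<forall>f::real ^ 'n \<Rightarrow> real.
          locally_integrable f \<longrightarrow> (\<forall>\<tau>>0. emeasure lebesgue {x. \<bar>f x\<bar> > \<tau>} < \<infinity>) \<longrightarrow>
          decreasing_rearrangement (wolff_potential \<alpha> \<psi> f) t \<le>
            ennreal C1 * (\<integral>\<^sup>+ s\<in>{t<..}. ennreal (s powr (\<alpha> / CARD('n) - 1)) *
              extend_profile \<psi> (ennreal (C2 * s powr (\<alpha> / CARD('n))) *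
                maximal_rearrangement (\<lambda>x. ennreal \<bar>f x\<bar>) s) \<partial>lebesgue)))
     \<and>
     (\<exists>C3>0. \<exists>C4>0. \<forall>\<psi>::real \<Rightarrow> real.
        \<psi> \<in> {0..} \<rightarrow> {0..} \<longrightarrow> mono_on {0..} \<psi> \<longrightarrow> (\<forall>s>0. continuous (at_left s) \<psi>) \<longrightarrow>
        (\<forall>t>0. \<forall>f::real ^ 'n \<Rightarrow> real.
          (\<forall>x. 0 \<le> f x) \<longrightarrow> radially_decreasing f \<longrightarrow>
          locally_integrable f \<longrightarrow> (\<forall>\<tau>>0. emeasure lebesgue {x. \<bar>f x\<bar> > \<tau>} < \<infinity>) \<longrightarrow>
          ennreal C3 * (\<integral>\<^sup>+ s\<in>{t<..}. ennreal (s powr (\<alpha> / CARD('n) - 1)) *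
            extend_profile \<psi> (ennreal (C4 * s powr (\<alpha> / CARD('n))) *
              maximal_rearrangement (\<lambda>x. ennreal \<bar>f x\<bar>) s) \<partial>lebesgue)
          \<le> decreasing_rearrangement (wolff_potential \<alpha> \<psi> f) t))"
proof -
  let ?n = "CARD('n)" and ?w = "unit_ball_vol CARD('n)"
  have w: "0 < ?w" by simp
  have root: "\<exists>c>0. ?w * c ^ ?n = y" if "0 < y" for y :: real
  proof -
    have "(root ?n (y / ?w)) ^ ?n = y / ?w"
      using that w by (intro real_root_pow_pos2) simp_all
    then show ?thesis
      using that w less_imp_neq[OF w] by (intro exI[of _ "root ?n (y / ?w)"]) simp
  qed
  \<comment> \<open>Radii of balls of volume 1 and 2. The lower bound is normalised through c/2,
    hence is used with c = 2b.\<close>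
  obtain a where a: "0 < a" "?w * a ^ ?n = 1" using root[of 1] by auto
  obtain b where b: "0 < b" "?w * b ^ ?n = 2" using root[of 2] by auto
  note upper = wolff_upper_bound[where 'a = "real ^ 'n" and c = a and \<alpha> = \<alpha>,
      unfolded rearranged_wolff_def DIM_cart DIM_real mult_1_right]
  note lower = wolff_lower_bound[where 'a = "real ^ 'n" and c = "2 * b" and \<alpha> = \<alpha>,
      unfolded rearranged_wolff_def DIM_cart DIM_real mult_1_right]
  have pos: "0 < 2 * a powr \<alpha> / \<alpha> + a powr \<alpha> / ?n" "0 < 2 * 5 ^ ?n * a powr (\<alpha> - ?n)"
    using a assms by (simp_all add: add_pos_pos)
  have b': "0 < 2 * b" "?w * (2 * b / 2) ^ ?n = 2"
    and pos': "0 < (2 * b) powr \<alpha> / ?n" "0 < (2 * b) powr (\<alpha> - ?n)"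
    using b by simp_all
  show ?thesis
  proof (rule conjI, goal_cases)
    case 1
    show ?case
      by (rule exI, rule conjI[OF pos(1)], rule exI, rule conjI[OF pos(2)],
          intro allI impI upper assms a locally_integrable_measurable)
  next
    case 2
    show ?case
      by (rule exI, rule conjI[OF pos'(1)], rule exI, rule conjI[OF pos'(2)],
          intro allI impI lower b' locally_integrable_measurable) simp_all
  qed
qed

end
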